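(* Let $D\subset\mathbb{R}^2$ be a domain and let $\Phi=\Phi(x_1,x_2):D\to\mathbb{R}$ be a smooth function satisfying on $D$ the two equations $$|\nabla \Phi|^2=G(\Phi),\qquad \Delta \Phi=R(\Phi),$$ with a differentiable function $G$ and an integrable function $R$ of one real variable. Then $\Phi$ satisfies $$J(\Phi,|\nabla \Phi|^2)=0\qquad\text{and}\qquad J(\Phi,\Delta\Phi)=0\quad\text{on } D,$$ and therefore $\Phi$ is part of a solution $(\Phi,\pi_0)$ of the system below, that is, there exists a function $\pi_0:D\to\mathbb{R}$ such that on $D$ $$\nabla\pi_0\cdot\nabla_\bot\Phi=0,$$ $$(\nabla_\bot \Phi \cdot \nabla)\nabla_\bot \Phi + l\,L\, \nabla_\bot \Phi + c_0 \nabla \pi_0=0.$$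
   Context: Notation: for a function $\Phi(x_1,x_2)$, $\nabla_\bot\Phi=(\Phi_{x_2},-\Phi_{x_1})$. $J(f,g)=f_{x_1}g_{x_2}-f_{x_2}g_{x_1}$ is the Jacobian. $L=\begin{pmatrix}0&-1\\1&0\end{pmatrix}$. The numbers $l>0$ (Coriolis parameter) and $c_0=\frac{\gamma}{\gamma-1}C^{1/\gamma}>0$, with $\gamma\in(1,2)$ and $C>0$, are fixed constants. For a vector field ${\bf u}=(u_1,u_2)$, $({\bf u}\cdot\nabla){\bf u}$ is the vector field $u_1\partial_{x_1}{\bf u}+u_2\partial_{x_2}{\bf u}$. The functions $G$ and $R$ are defined on an interval of $\mathbb{R}$ containing the range of $\Phi$. *)

theory Defs
  imports "HOL-Analysis.Analysis"
begin

text \<open>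
  Functions on an open set D of the plane are total functions on \<^typ>\<open>real^2\<close>; on D the operators
  below depend only on the values on D. They carry their intended meaning only where the
  derivatives involved exist.
\<close>

definition partial :: "2 \<Rightarrow> (real^2 \<Rightarrow> 'b::real_normed_vector) \<Rightarrow> real^2 \<Rightarrow> 'b" where
  "partial i f x = vector_derivative (\<lambda>t. f (x + t *\<^sub>R axis i 1)) (at 0)"

definition grad :: "(real^2 \<Rightarrow> real) \<Rightarrow> real^2 \<Rightarrow> real^2" where
  "grad f x = (\<chi> i. partial i f x)"

definition perp_grad :: "(real^2 \<Rightarrow> real) \<Rightarrow> real^2 \<Rightarrow> real^2" where
  "perp_grad f x = vector [partial 2 f x, - partial 1 f x]"

definition laplacian :: "(real^2 \<Rightarrow> real) \<Rightarrow> real^2 \<Rightarrow> real" where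
  "laplacian f x = (\<Sum>i\<in>UNIV. partial i (partial i f) x)"

definition jac :: "(real^2 \<Rightarrow> real) \<Rightarrow> (real^2 \<Rightarrow> real) \<Rightarrow> real^2 \<Rightarrow> real" where
  "jac f g x = partial 1 f x * partial 2 g x - partial 2 f x * partial 1 g x"

definition advect :: "(real^2 \<Rightarrow> real^2) \<Rightarrow> (real^2 \<Rightarrow> real^2) \<Rightarrow> real^2 \<Rightarrow> real^2" where
  "advect u v x = u x $ 1 *\<^sub>R partial 1 v x + u x $ 2 *\<^sub>R partial 2 v x"

definition rot_mat :: "real^2^2" where
  "rot_mat = vector [vector [0, -1], vector [1, 0]]"

text \<open>
  Infinite differentiability on an open set: the iterated partial derivatives of all orders exist
  and are (Frechet) differentiable; in particular they are all continuous.
\<close>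

definition smooth_on :: "(real^2) set \<Rightarrow> (real^2 \<Rightarrow> real) \<Rightarrow> bool" where
  "smooth_on D f \<longleftrightarrow> (\<forall>is. foldr partial is f differentiable_on D)"

end

theory Submission
  imports Defs
begin

text \<open>
  Writing \<open>u\<close> for the field \<open>perp_grad \<Phi>\<close>, one has \<open>L u = \<nabla>\<Phi>\<close> and, by symmetry of second
  derivatives, \<open>(u \<cdot> \<nabla>) u = \<nabla>|\<nabla>\<Phi>|\<^sup>2 / 2 - \<Delta>\<Phi> \<nabla>\<Phi>\<close>. If \<open>F\<close> is an indefinite integral of \<open>R\<close>, then
  \<open>\<nabla>(F \<circ> \<Phi>) = \<Delta>\<Phi> \<nabla>\<Phi>\<close>, without differentiating \<open>F\<close> itself: by the intermediate value theorem
  the values between \<open>\<Phi> x\<close> and \<open>\<Phi> y\<close> are attained on the segment from \<open>x\<close> to \<open>y\<close>, so on them \<open>R\<close>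
  is as close to \<open>R (\<Phi> x)\<close> as the continuity of \<open>\<Delta>\<Phi> = R \<circ> \<Phi>\<close> dictates. Hence \<open>\<pi>\<^sub>0\<close> can be taken to
  be \<open>- (|\<nabla>\<Phi>|\<^sup>2 / 2 - F \<circ> \<Phi> + l \<Phi>) / c\<^sub>0\<close>, and \<open>J(\<Phi>, \<Delta>\<Phi>) = 0\<close> says that the gradient \<open>\<Delta>\<Phi> \<nabla>\<Phi>\<close> is
  curl free.
\<close>

section \<open>Symmetry of second derivatives at a point\<close>

text \<open>The mean value theorem in direction \<open>a\<close> turns the second difference into
  \<open>t\<close> times a first difference of \<open>\<lambda>y. f' y a\<close>; linearising both
  of its terms at \<open>x\<close> leaves \<open>t * A b\<close> up to an error small compared with
  \<open>t\<close>. Differentiability of this one directional derivative at the single point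
  \<open>x\<close> suffices.\<close>

lemma second_difference_tendsto:
  fixes f :: "'a::real_normed_vector \<Rightarrow> real"
  assumes "open D" "x \<in> D"
    and f': "\<And>y. y \<in> D \<Longrightarrow> (f has_derivative f' y) (at y)"
    and A: "((\<lambda>y. f' y a) has_derivative A) (at x)"
  shows "((\<lambda>t. (f (x + t *\<^sub>R a + t *\<^sub>R b) - f (x + t *\<^sub>R a) - f (x + t *\<^sub>R b) + f x) / t\<^sup>2)
           \<longlongrightarrow> A b) (at_right 0)"
proof (rule tendstoI)
  fix e :: real assume "e > 0"
  \<comment> \<open>All points that occur lie within \<open>t * N\<close> of \<open>x\<close>; the
    summand 1 keeps \<open>N\<close> positive when \<open>a\<close> and \<open>b\<close>
    vanish.\<close>
  define N where "N = norm a + norm b + 1"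
  have "N > 0" unfolding N_def by (simp add: add_nonneg_pos)
  \<comment> \<open>Two linearisation errors of at most \<open>e1 * (t * N)\<close> each will be
    added, so the factor 3 leaves a strict inequality.\<close>
  define e1 where "e1 = e / (3 * N)"
  have "e1 > 0" using \<open>e > 0\<close> \<open>N > 0\<close> by (simp add: e1_def)
  obtain d1 where d1: "d1 > 0" "ball x d1 \<subseteq> D"
    using assms(1,2) openE by blast
  interpret A: bounded_linear A using A by (rule has_derivative_bounded_linear)
  obtain d2 where d2: "d2 > 0"
    "\<And>y. norm (y - x) < d2 \<Longrightarrow> \<bar>f' y a - f' x a - A (y - x)\<bar> \<le> e1 * norm (y - x)"
    using A \<open>e1 > 0\<close> unfolding has_derivative_at_alt real_norm_def by blast
  define d where "d = min d1 d2 / N"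
  have "d > 0" using d1 d2 \<open>N > 0\<close> by (simp add: d_def)
  have "dist ((f (x + t *\<^sub>R a + t *\<^sub>R b) - f (x + t *\<^sub>R a) - f (x + t *\<^sub>R b) + f x) / t\<^sup>2) (A b) < e"
    if t: "0 < t" "t < d" for t
  proof -
    have tN: "t * N < min d1 d2" using t \<open>N > 0\<close> by (simp add: d_def field_simps)
    have bound: "norm (s *\<^sub>R a + r *\<^sub>R b) \<le> t * N" if "0 \<le> s" "s \<le> t" "0 \<le> r" "r \<le> t" for s r
    proof -
      have "norm (s *\<^sub>R a + r *\<^sub>R b) \<le> s * norm a + r * norm b"
        using norm_triangle_ineq[of "s *\<^sub>R a" "r *\<^sub>R b"] that by simp
      also have "\<dots> \<le> t * norm a + t * norm b"
        using that by (intro add_mono mult_right_mono) auto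
      also have "\<dots> \<le> t * N" using t by (simp add: N_def algebra_simps)
      finally show ?thesis .
    qed
    have inD: "x + s *\<^sub>R a + r *\<^sub>R b \<in> D" if "0 \<le> s" "s \<le> t" "0 \<le> r" "r \<le> t" for s r
    proof -
      have "x + (s *\<^sub>R a + r *\<^sub>R b) \<in> ball x d1"
        using bound[OF that] tN by (simp add: dist_norm del: minus_add_distrib)
      then show ?thesis using d1 by (auto simp: add.assoc)
    qed
    \<comment> \<open>The increment in direction \<open>b\<close>, as a function of the position
      along \<open>a\<close>: \<open>\<phi> t - \<phi> 0\<close> is the second difference, while the
      derivative of \<open>\<phi>\<close> involves \<open>f'\<close> in direction \<open>a\<close>
      only.\<close>
    define \<phi> where "\<phi> s = f (x + s *\<^sub>R a + t *\<^sub>R b) - f (x + s *\<^sub>R a)" for s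
    have der: "(\<phi> has_real_derivative f' (x + s *\<^sub>R a + t *\<^sub>R b) a - f' (x + s *\<^sub>R a) a) (at s)"
      if s: "0 \<le> s" "s \<le> t" for s
    proof -
      have 1: "x + s *\<^sub>R a + t *\<^sub>R b \<in> D" "x + s *\<^sub>R a \<in> D"
        using inD[of s t] inD[of s 0] s t by auto
      have lin: "f' y (h *\<^sub>R a) = h * f' y a" if "y \<in> D" for y h
        using has_derivative_linear[OF f'[OF that]] by (simp add: linear_cmul)
      have "((\<lambda>s. f (x + s *\<^sub>R a + t *\<^sub>R b)) has_derivative (\<lambda>h. f' (x + s *\<^sub>R a + t *\<^sub>R b) (h *\<^sub>R a))) (at s)"
        by (rule has_derivative_compose[where f = "\<lambda>s. x + s *\<^sub>R a + t *\<^sub>R b" and g = f, OF _ f'[OF 1(1)]]) (auto intro!: derivative_eq_intros)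
      moreover have "((\<lambda>s. f (x + s *\<^sub>R a)) has_derivative (\<lambda>h. f' (x + s *\<^sub>R a) (h *\<^sub>R a))) (at s)"
        by (rule has_derivative_compose[where f = "\<lambda>s. x + s *\<^sub>R a" and g = f, OF _ f'[OF 1(2)]]) (auto intro!: derivative_eq_intros)
      ultimately have "(\<phi> has_derivative (\<lambda>h. f' (x + s *\<^sub>R a + t *\<^sub>R b) (h *\<^sub>R a) - f' (x + s *\<^sub>R a) (h *\<^sub>R a))) (at s)"
        unfolding \<phi>_def by (rule has_derivative_diff)
      then show ?thesis
        unfolding has_field_derivative_def using 1
        by (simp add: lin mult_commute_abs flip: right_diff_distrib)
    qed
    obtain s where s: "0 < s" "s < t"
      and eq: "\<phi> t - \<phi> 0 = (t - 0) * (f' (x + s *\<^sub>R a + t *\<^sub>R b) a - f' (x + s *\<^sub>R a) a)"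
      using MVT2[OF t(1) der] by blast
    have le: "\<bar>f' (x + s *\<^sub>R a + r *\<^sub>R b) a - f' x a - A (s *\<^sub>R a + r *\<^sub>R b)\<bar> \<le> e1 * (t * N)"
      if "0 \<le> r" "r \<le> t" for r
    proof -
      have n: "norm (s *\<^sub>R a + r *\<^sub>R b) \<le> t * N" using bound[of s r] s that by simp
      then have "\<bar>f' (x + (s *\<^sub>R a + r *\<^sub>R b)) a - f' x a - A (s *\<^sub>R a + r *\<^sub>R b)\<bar>
          \<le> e1 * norm (s *\<^sub>R a + r *\<^sub>R b)"
        using d2(2)[of "x + (s *\<^sub>R a + r *\<^sub>R b)"] tN by simp
      also have "\<dots> \<le> e1 * (t * N)" using n \<open>e1 > 0\<close> by simp
      finally show ?thesis by (simp add: add.assoc)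
    qed
    \<comment> \<open>Subtracting the estimates for \<open>r = t\<close> and \<open>r = 0\<close>
      cancels \<open>A (s *\<^sub>R a)\<close>, so the unknown intermediate point \<open>s\<close>
      drops out.\<close>
    have "\<bar>f' (x + s *\<^sub>R a + t *\<^sub>R b) a - f' (x + s *\<^sub>R a) a - t * A b\<bar> \<le> 2 * (e1 * (t * N))"
      using le[of t] le[of 0] t by (simp add: A.add A.scaleR)
    then have est: "\<bar>(f' (x + s *\<^sub>R a + t *\<^sub>R b) a - f' (x + s *\<^sub>R a) a) / t - A b\<bar> \<le> 2 * e1 * N"
      using t by (simp add: field_simps abs_if split: if_splits)
    have "2 * e1 * N < e" using \<open>N > 0\<close> \<open>e > 0\<close> by (simp add: e1_def)
    moreover have "(f (x + t *\<^sub>R a + t *\<^sub>R b) - f (x + t *\<^sub>R a) - f (x + t *\<^sub>R b) + f x) / t\<^sup>2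
        = (f' (x + s *\<^sub>R a + t *\<^sub>R b) a - f' (x + s *\<^sub>R a) a) / t"
    proof -
      have "f (x + t *\<^sub>R a + t *\<^sub>R b) - f (x + t *\<^sub>R a) - f (x + t *\<^sub>R b) + f x
          = t * (f' (x + s *\<^sub>R a + t *\<^sub>R b) a - f' (x + s *\<^sub>R a) a)"
        using eq by (simp add: \<phi>_def)
      then show ?thesis using t by (simp add: power2_eq_square)
    qed
    ultimately show ?thesis using est by (simp add: dist_real_def)
  qed
  then show "\<forall>\<^sub>F t in at_right 0. dist ((f (x + t *\<^sub>R a + t *\<^sub>R b) - f (x + t *\<^sub>R a) - f (x + t *\<^sub>R b) + f x) / t\<^sup>2) (A b) < e"
    unfolding eventually_at_right_field using \<open>d > 0\<close> by blast
qed

text \<open>The second difference is symmetric in \<open>a\<close> and \<open>b\<close>, so one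
  quotient has both numbers as its limit. No continuity of second derivatives enters.\<close>

lemma has_derivative_symmetric_second:
  fixes f :: "'a::real_normed_vector \<Rightarrow> real"
  assumes "open D" "x \<in> D"
    and "\<And>y. y \<in> D \<Longrightarrow> (f has_derivative f' y) (at y)"
    and "((\<lambda>y. f' y a) has_derivative A) (at x)"
    and "((\<lambda>y. f' y b) has_derivative B) (at x)"
  shows "A b = B a"
proof (rule tendsto_unique[OF trivial_limit_at_right_real])
  show "((\<lambda>t. (f (x + t *\<^sub>R a + t *\<^sub>R b) - f (x + t *\<^sub>R a) - f (x + t *\<^sub>R b) + f x) / t\<^sup>2)
      \<longlongrightarrow> A b) (at_right 0)"
    by (rule second_difference_tendsto[OF assms(1-4)])
  show "((\<lambda>t. (f (x + t *\<^sub>R a + t *\<^sub>R b) - f (x + t *\<^sub>R a) - f (x + t *\<^sub>R b) + f x) / t\<^sup>2)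
      \<longlongrightarrow> B a) (at_right 0)"
    using second_difference_tendsto[OF assms(1-3,5), of a] by (simp add: algebra_simps)
qed

section \<open>Chain rule for an indefinite integral\<close>

lemma has_derivative_indefinite_integral_compose:
  fixes f :: "'a::real_normed_vector \<Rightarrow> real" and R :: "real \<Rightarrow> real"
  assumes "open D" "connected D" "D \<noteq> {}"
    and cont_f: "continuous_on D f"
    and cont_R: "continuous_on D (\<lambda>x. R (f x))"
    and R: "\<And>a b. {a..b} \<subseteq> f ` D \<Longrightarrow> R integrable_on {a..b}"
  obtains F where "\<And>x f'. x \<in> D \<Longrightarrow> (f has_derivative f') (at x) \<Longrightarrow>
    ((\<lambda>y. F (f y)) has_derivative (\<lambda>h. R (f x) * f' h)) (at x)"
proof -
  obtain c where c: "c \<in> f ` D" using \<open>D \<noteq> {}\<close> by blast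
  \<comment> \<open>The signed integral from \<open>c\<close> to \<open>s\<close>: whichever
    interval is reversed is empty or a point and contributes 0.\<close>
  define F where "F s = integral {c..s} R - integral {s..c} R" for s
  have sub: "{u..v} \<subseteq> f ` D" if "u \<in> f ` D" "v \<in> f ` D" for u v
    using connected_contains_Icc[OF connected_continuous_image[OF cont_f \<open>connected D\<close>] that] .
  have F: "F v - F u = integral {u..v} R" if uv: "u \<in> f ` D" "v \<in> f ` D" "u \<le> v" for u v
  proof -
    have comb: "integral {p..q} R + integral {q..r} R = integral {p..r} R"
      if "p \<in> f ` D" "r \<in> f ` D" "p \<le> q" "q \<le> r" for p q r
      using that by (intro Henstock_Kurzweil_Integration.integral_combine R sub) auto
    have triv: "integral {p..q} R = 0" if "q \<le> p" for p q
      using that by (cases "p = q") auto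
    consider "c \<le> u" | "u \<le> c" "c \<le> v" | "v \<le> c" by linarith
    then show ?thesis
    proof cases
      case 1
      then show ?thesis using comb[of c v u] triv[of c u] triv[of c v] uv c by (simp add: F_def)
    next
      case 2
      then show ?thesis using comb[of u v c] triv[of u c] triv[of c v] uv c by (simp add: F_def)
    next
      case 3
      then show ?thesis using comb[of u c v] triv[of u c] triv[of v c] uv c by (simp add: F_def)
    qed
  qed
  have F_le: "\<bar>F v - F u - k * (v - u)\<bar> \<le> e * (v - u)"
    if uv: "u \<in> f ` D" "v \<in> f ` D" "u \<le> v"
      and "e > 0" and k: "\<And>w. u \<le> w \<Longrightarrow> w \<le> v \<Longrightarrow> \<bar>R w - k\<bar> \<le> e" for u v k e
  proof -
    have "(R has_integral (F v - F u)) {u..v}"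
      using F[OF uv] R[OF sub[OF uv(1,2)]] by (simp add: integrable_integral)
    moreover have "((\<lambda>_. k) has_integral (v - u) * k) {u..v}"
      using has_integral_const_real[of k u v] uv by simp
    ultimately have "((\<lambda>w. R w - k) has_integral (F v - F u) - (v - u) * k) {u..v}"
      by (rule has_integral_diff)
    then have "norm (F v - F u - (v - u) * k) \<le> e * measure lborel {u..v}"
      by (rule has_integral_bound_real[OF less_imp_le[OF \<open>e > 0\<close>] finite.emptyI]) (use k in auto)
    then show ?thesis using uv by (simp add: mult.commute)
  qed
  have "((\<lambda>y. F (f y)) has_derivative (\<lambda>h. R (f x) * f' h)) (at x)"
    if "x \<in> D" and f': "(f has_derivative f') (at x)" for x f'
  proof -
    define k where "k = R (f x)"
    \<comment> \<open>Removing the expected linear part reduces the claim to \<open>H\<close> having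
      derivative zero at \<open>x\<close>.\<close>
    define H where "H y = F (f y) - k * f y" for y
    interpret f': bounded_linear f' using f' by (rule has_derivative_bounded_linear)
    obtain K where K: "K > 0" "\<And>h. norm (f' h) \<le> norm h * K" using f'.pos_bounded by blast
    have "(H has_derivative (\<lambda>_. 0)) (at x)"
      unfolding has_derivative_at_alt
    proof (intro conjI allI impI)
      fix e :: real assume "e > 0"
      \<comment> \<open>Near \<open>x\<close>, \<open>\<bar>f y - f x\<bar>\<close> is at most
        \<open>(K + 1) * norm (y - x)\<close>: \<open>K\<close> bounds \<open>f'\<close>, and 1 is
        the crude tolerance chosen for the remainder when \<open>d3\<close> is obtained.\<close>
      define e1 where "e1 = e / (K + 1)"
      have "e1 > 0" using \<open>e > 0\<close> K by (simp add: e1_def)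
      obtain d1 where d1: "d1 > 0" "ball x d1 \<subseteq> D"
        using \<open>open D\<close> \<open>x \<in> D\<close> openE by blast
      have "isCont (\<lambda>x. R (f x)) x"
        using cont_R \<open>open D\<close> \<open>x \<in> D\<close> by (simp add: continuous_on_eq_continuous_at)
      then obtain d2 where d2: "d2 > 0" "\<And>y. dist y x < d2 \<Longrightarrow> \<bar>R (f y) - k\<bar> < e1"
        unfolding continuous_at_eps_delta k_def dist_real_def using \<open>e1 > 0\<close> by blast
      obtain d3 where d3: "d3 > 0"
        "\<And>y. norm (y - x) < d3 \<Longrightarrow> norm (f y - f x - f' (y - x)) \<le> 1 * norm (y - x)"
        using f' unfolding has_derivative_at_alt using zero_less_one by blast
      define d where "d = min d1 (min d2 d3)"
      have "norm (H y - H x - 0) \<le> e * norm (y - x)" if y: "norm (y - x) < d" for y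
      proof -
        have seg: "closed_segment x y \<subseteq> ball x d"
          using y d1 d2 d3 by (intro closed_segment_subset) (auto simp: dist_norm norm_minus_commute d_def)
        have segD: "closed_segment x y \<subseteq> D" using seg d1(2) by (force simp: d_def)
        have "connected (f ` closed_segment x y)"
          using cont_f segD by (intro connected_continuous_image) (auto intro: continuous_on_subset)
        then have ivt: "{p..q} \<subseteq> f ` closed_segment x y"
          if "p \<in> f ` closed_segment x y" "q \<in> f ` closed_segment x y" for p q
          using connected_contains_Icc that by blast
        have close: "\<bar>R w - k\<bar> \<le> e1" if w: "w \<in> {f x..f y} \<union> {f y..f x}" for w
        proof -
          have "w \<in> f ` closed_segment x y"
            using w ivt[of "f x" "f y"] ivt[of "f y" "f x"] by blast
          then obtain z where "w = f z" "z \<in> ball x d" using seg by blast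
          then show ?thesis using d2(2)[of z] by (simp add: d_def dist_commute)
        qed
        have D: "f x \<in> f ` D" "f y \<in> f ` D" using segD by auto
        have "\<bar>F (f y) - F (f x) - k * (f y - f x)\<bar> \<le> e1 * \<bar>f y - f x\<bar>"
        proof (cases "f x \<le> f y")
          case True
          then show ?thesis using F_le[OF D True \<open>e1 > 0\<close>, of k] close by auto
        next
          case False
          then have "f y \<le> f x" by simp
          from F_le[OF D(2,1) this \<open>e1 > 0\<close>, of k] close this show ?thesis
            by (auto simp: algebra_simps abs_minus_commute)
        qed
        also have "\<bar>f y - f x\<bar> \<le> norm (y - x) * K + norm (y - x)"
          using d3(2)[of y] K(2)[of "y - x"] y by (simp add: d_def)
        then have "e1 * \<bar>f y - f x\<bar> \<le> e1 * (norm (y - x) * K + norm (y - x))"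
          using \<open>e1 > 0\<close> by simp
        also have "\<dots> = e * norm (y - x)" using K by (simp add: e1_def field_simps)
        finally show ?thesis by (simp add: H_def algebra_simps)
      qed
      moreover have "d > 0" using d1 d2 d3 by (simp add: d_def)
      ultimately show "\<exists>d>0. \<forall>y. norm (y - x) < d \<longrightarrow> norm (H y - H x - 0) \<le> e * norm (y - x)"
        by blast
    qed simp
    then have "((\<lambda>y. H y + k * f y) has_derivative (\<lambda>h. 0 + k * f' h)) (at x)"
      using f' by (intro has_derivative_add has_derivative_mult_right)
    then show ?thesis by (simp add: H_def k_def)
  qed
  then show ?thesis using that by blast
qed

section \<open>Gradients and partial derivatives in the plane\<close>

text \<open>Chain rule along the axis line through \<open>x\<close>. The codomain is left general so
  that the rule also applies to the vector field \<open>perp_grad f\<close>.\<close>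

lemma partial_eq:
  assumes "(f has_derivative f') (at x)"
  shows "partial i f x = f' (axis i 1)"
proof -
  have "((\<lambda>t. f (x + t *\<^sub>R axis i 1)) has_derivative (\<lambda>h. f' (h *\<^sub>R axis i 1))) (at 0)"
    by (rule has_derivative_compose[where g = f]) (use assms in \<open>auto intro!: derivative_eq_intros\<close>)
  then have "((\<lambda>t. f (x + t *\<^sub>R axis i 1)) has_vector_derivative f' (axis i 1)) (at 0)"
    using has_derivative_linear[OF assms] by (simp add: has_vector_derivative_def linear_cmul)
  then show ?thesis unfolding partial_def by (rule vector_derivative_at)
qed

lemma has_derivative_grad:
  assumes "f differentiable (at x)"
  shows "(f has_derivative (\<lambda>h. grad f x \<bullet> h)) (at x)"
proof -
  obtain f' where f': "(f has_derivative f') (at x)"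
    using assms by (auto simp: differentiable_def)
  interpret f': bounded_linear f' using f' by (rule has_derivative_bounded_linear)
  have "f' h = grad f x \<bullet> h" for h
  proof -
    have h: "h = h $ 1 *\<^sub>R axis 1 1 + h $ 2 *\<^sub>R axis 2 1"
      by (simp add: vec_eq_iff forall_2 axis_def)
    have "f' h = h $ 1 * f' (axis 1 1) + h $ 2 * f' (axis 2 1)"
      by (subst h) (simp add: f'.add f'.scaleR)
    then show ?thesis by (simp add: grad_def partial_eq[OF f'] inner_vec_def sum_2)
  qed
  then show ?thesis using f' by (metis ext)
qed

lemma grad_eq:
  assumes "(f has_derivative (\<lambda>h. g \<bullet> h)) (at x)"
  shows "grad f x = g"
  by (simp add: vec_eq_iff grad_def partial_eq[OF assms] inner_axis)

lemma grad_nth: "grad f x $ i = partial i f x"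
  by (simp add: grad_def)

lemma smooth_on_foldr_partial:
  assumes "open D" "smooth_on D f" "x \<in> D"
  shows "foldr partial is f differentiable (at x)"
  using assms by (simp add: smooth_on_def differentiable_on_eq_differentiable_at)

text \<open>The derivative of \<open>f\<close> in direction \<open>axis j 1\<close> is
  \<open>partial j f\<close>, so this is the symmetry of second derivatives for two axis
  directions.\<close>

lemma partial_commute:
  fixes f :: "real^2 \<Rightarrow> real"
  assumes "open D" "x \<in> D"
    and "\<And>y. y \<in> D \<Longrightarrow> f differentiable (at y)"
    and "partial i f differentiable (at x)" "partial j f differentiable (at x)"
  shows "partial i (partial j f) x = partial j (partial i f) x"
proof -
  have "grad (partial j f) x \<bullet> axis i 1 = grad (partial i f) x \<bullet> axis j 1"
  proof (rule has_derivative_symmetric_second[OF assms(1,2) has_derivative_grad[OF assms(3)]])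
    show "((\<lambda>y. grad f y \<bullet> axis j 1) has_derivative (\<lambda>h. grad (partial j f) x \<bullet> h)) (at x)"
      using has_derivative_grad[OF assms(5)] by (simp add: inner_axis grad_nth)
    show "((\<lambda>y. grad f y \<bullet> axis i 1) has_derivative (\<lambda>h. grad (partial i f) x \<bullet> h)) (at x)"
      using has_derivative_grad[OF assms(4)] by (simp add: inner_axis grad_nth)
  qed
  then show ?thesis by (simp add: inner_axis grad_nth)
qed

section \<open>Jacobian and advection identities\<close>

lemma norm_grad_power2: "(norm (grad f y))\<^sup>2 = (partial 1 f y)\<^sup>2 + (partial 2 f y)\<^sup>2"
  by (simp add: power2_norm_eq_inner) (simp add: inner_vec_def sum_2 grad_nth power2_eq_square)

lemma rot_mat_perp_grad: "rot_mat *v perp_grad f x = grad f x"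
  by (simp add: vec_eq_iff forall_2 rot_mat_def perp_grad_def matrix_vector_mult_def sum_2 grad_nth)

text \<open>Translates the orthogonality required of the gradient of \<open>\<pi>\<^sub>0\<close>
  into vanishing Jacobians.\<close>

lemma inner_perp_grad: "grad g x \<bullet> perp_grad f x = - jac f g x"
  by (simp add: inner_vec_def sum_2 grad_nth perp_grad_def jac_def)

lemma jac_eq_0_if_grad_parallel:
  assumes "grad g x = k *\<^sub>R grad f x"
  shows "jac f g x = 0"
  using arg_cong[OF assms, of "\<lambda>v. v $ 1"] arg_cong[OF assms, of "\<lambda>v. v $ 2"]
  by (simp add: jac_def grad_nth)

lemma jac_eq_0_if_compose:
  assumes "open D" "x \<in> D" "f differentiable (at x)" "G differentiable_on I" "f ` D \<subseteq> I"
    and g: "\<And>y. y \<in> D \<Longrightarrow> g y = G (f y)"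
  shows "jac f g x = 0"
proof -
  have "G differentiable (at (f x) within I)"
    using assms by (auto simp: differentiable_on_def)
  then obtain k where "(G has_real_derivative k) (at (f x) within I)"
    by (auto simp: real_differentiable_def)
  then have "(G has_derivative (*) k) (at (f x) within f ` D)"
    using \<open>f ` D \<subseteq> I\<close> has_derivative_subset unfolding has_field_derivative_def by blast
  then have "((\<lambda>y. G (f y)) has_derivative (\<lambda>h. k * (grad f x \<bullet> h))) (at x within D)"
    using has_derivative_at_withinI[OF has_derivative_grad[OF assms(3)]]
    by (rule has_derivative_in_compose[rotated])
  then have "(g has_derivative (\<lambda>h. k * (grad f x \<bullet> h))) (at x within D)"
    by (rule has_derivative_transform[OF \<open>x \<in> D\<close>, rotated]) (rule g)
  then have "(g has_derivative (\<lambda>h. (k *\<^sub>R grad f x) \<bullet> h)) (at x)"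
    using at_within_open[OF \<open>x \<in> D\<close> \<open>open D\<close>] by simp
  then show ?thesis using grad_eq jac_eq_0_if_grad_parallel by blast
qed

text \<open>The Lamb form of the advection term for the velocity \<open>perp_grad f\<close>: its
  speed is \<open>norm (grad f y)\<close>, its vorticity is minus the Laplacian, and its rotation by
  \<open>rot_mat\<close> is \<open>grad f\<close>.\<close>

lemma advect_perp_grad:
  assumes "partial 1 f differentiable (at x)" "partial 2 f differentiable (at x)"
    and comm: "partial 1 (partial 2 f) x = partial 2 (partial 1 f) x"
  shows "advect (perp_grad f) (perp_grad f) x
    = (1/2) *\<^sub>R grad (\<lambda>y. (norm (grad f y))\<^sup>2) x - laplacian f x *\<^sub>R grad f x"
proof -
  note D = assms(1,2)[THEN has_derivative_grad]
  have "((\<lambda>y. (norm (grad f y))\<^sup>2) has_derivative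
      (\<lambda>h. (2 *\<^sub>R (partial 1 f x *\<^sub>R grad (partial 1 f) x + partial 2 f x *\<^sub>R grad (partial 2 f) x)) \<bullet> h)) (at x)"
    unfolding norm_grad_power2
    by (rule derivative_eq_intros D refl)+ (auto simp: fun_eq_iff inner_left_distrib algebra_simps)
  then have q: "grad (\<lambda>y. (norm (grad f y))\<^sup>2) x
      = 2 *\<^sub>R (partial 1 f x *\<^sub>R grad (partial 1 f) x + partial 2 f x *\<^sub>R grad (partial 2 f) x)"
    by (rule grad_eq)
  \<comment> \<open>With constant axis vectors split off, the derivative rules for scalar
    coefficients apply.\<close>
  have eq: "perp_grad f = (\<lambda>y. partial 2 f y *\<^sub>R axis 1 1 - partial 1 f y *\<^sub>R axis 2 1)"
    by (simp add: fun_eq_iff vec_eq_iff forall_2 perp_grad_def axis_def)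
  have "(perp_grad f has_derivative
      (\<lambda>h. (grad (partial 2 f) x \<bullet> h) *\<^sub>R axis 1 1 - (grad (partial 1 f) x \<bullet> h) *\<^sub>R axis 2 1)) (at x)"
    unfolding eq by (rule derivative_eq_intros D refl)+ simp
  from partial_eq[OF this]
  have p: "partial i (perp_grad f) x
      = partial i (partial 2 f) x *\<^sub>R axis 1 1 - partial i (partial 1 f) x *\<^sub>R axis 2 1" for i
    by (simp add: inner_axis grad_nth)
  show ?thesis
    by (simp add: vec_eq_iff forall_2 advect_def p q axis_def grad_nth laplacian_def sum_2 comm)
       (simp add: perp_grad_def algebra_simps comm)
qed

section \<open>Construction of the potential and the equations on \<open>D\<close>\<close>

theorem theorem3p1:
  fixes D :: "(real^2) set" and \<Phi> :: "real^2 \<Rightarrow> real"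
    and I :: "real set" and G R :: "real \<Rightarrow> real"
    and l \<gamma> C c\<^sub>0 :: real
  assumes "l > 0" and "1 < \<gamma>" and "\<gamma> < 2" and "C > 0"
    and "c\<^sub>0 = \<gamma> / (\<gamma> - 1) * C powr (1 / \<gamma>)"
    and "open D" and "connected D" and "D \<noteq> {}"
    and "smooth_on D \<Phi>"
    and "is_interval I" and "\<Phi> ` D \<subseteq> I"
    and "G differentiable_on I"
    and "\<And>a b. {a..b} \<subseteq> I \<Longrightarrow> R integrable_on {a..b}"
    and "\<And>x. x \<in> D \<Longrightarrow> (norm (grad \<Phi> x))\<^sup>2 = G (\<Phi> x)"
    and "\<And>x. x \<in> D \<Longrightarrow> laplacian \<Phi> x = R (\<Phi> x)"
  shows "(\<forall>x\<in>D. jac \<Phi> (\<lambda>y. (norm (grad \<Phi> y))\<^sup>2) x = 0) \<and>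
         (\<forall>x\<in>D. jac \<Phi> (laplacian \<Phi>) x = 0) \<and>
         (\<exists>\<pi>\<^sub>0 :: real^2 \<Rightarrow> real. \<pi>\<^sub>0 differentiable_on D \<and>
            (\<forall>x\<in>D. grad \<pi>\<^sub>0 x \<bullet> perp_grad \<Phi> x = 0 \<and>
                    advect (perp_grad \<Phi>) (perp_grad \<Phi>) x
                      + l *\<^sub>R (rot_mat *v perp_grad \<Phi> x)
                      + c\<^sub>0 *\<^sub>R grad \<pi>\<^sub>0 x = 0))"
proof -
  note smooth = smooth_on_foldr_partial[OF \<open>open D\<close> \<open>smooth_on D \<Phi>\<close>]
  have d0: "\<Phi> differentiable (at x)" if "x \<in> D" for x
    using smooth[OF that, of "[]"] by simp
  have d1: "partial i \<Phi> differentiable (at x)" if "x \<in> D" for x i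
    using smooth[OF that, of "[i]"] by simp
  have d2: "partial i (partial j \<Phi>) differentiable (at x)" if "x \<in> D" for x i j
    using smooth[OF that, of "[i, j]"] by simp
  have comm: "partial i (partial j \<Phi>) x = partial j (partial i \<Phi>) x" if "x \<in> D" for x i j
    using that by (intro partial_commute[OF \<open>open D\<close>] d0 d1)
  define q where "q = (\<lambda>y. (norm (grad \<Phi> y))\<^sup>2)"
  have q_diff: "q differentiable (at x)" if "x \<in> D" for x
    unfolding q_def norm_grad_power2 using d1[OF that] by (intro differentiable_add differentiable_power)
  have lap_eq: "laplacian \<Phi> = (\<lambda>y. partial 1 (partial 1 \<Phi>) y + partial 2 (partial 2 \<Phi>) y)"
    by (simp add: fun_eq_iff laplacian_def sum_2)
  have lap_diff: "laplacian \<Phi> differentiable (at x)" if "x \<in> D" for x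
    unfolding lap_eq using d2[OF that] by (intro differentiable_add)

  have jac_q: "jac \<Phi> q x = 0" if "x \<in> D" for x
    using jac_eq_0_if_compose[OF \<open>open D\<close> that d0[OF that] \<open>G differentiable_on I\<close> \<open>\<Phi> ` D \<subseteq> I\<close>]
      assms(14) by (simp add: q_def)

  have "continuous_on D \<Phi>" "continuous_on D (laplacian \<Phi>)"
    using d0 lap_diff \<open>open D\<close>
    by (auto intro!: differentiable_imp_continuous_on simp: differentiable_on_eq_differentiable_at)
  \<comment> \<open>Continuity is inherited from the Laplacian, which agrees with \<open>R\<close>
    composed with \<open>\<Phi>\<close> on \<open>D\<close>; \<open>R\<close> itself is only assumed
    integrable.\<close>
  then have "continuous_on D (\<lambda>x. R (\<Phi> x))"
    using assms(15) continuous_on_cong by fastforce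
  moreover have "R integrable_on {a..b}" if "{a..b} \<subseteq> \<Phi> ` D" for a b
    using that \<open>\<Phi> ` D \<subseteq> I\<close> assms(13) by blast
  ultimately obtain F where F: "\<And>x f'. x \<in> D \<Longrightarrow> (\<Phi> has_derivative f') (at x) \<Longrightarrow>
      ((\<lambda>y. F (\<Phi> y)) has_derivative (\<lambda>h. R (\<Phi> x) * f' h)) (at x)"
    using has_derivative_indefinite_integral_compose[OF \<open>open D\<close> \<open>connected D\<close> \<open>D \<noteq> {}\<close> \<open>continuous_on D \<Phi>\<close>]
    by metis
  define P where "P = (\<lambda>y. F (\<Phi> y))"
  have P: "(P has_derivative (\<lambda>h. laplacian \<Phi> x * (grad \<Phi> x \<bullet> h))) (at x)" if "x \<in> D" for x
    using F[OF that has_derivative_grad[OF d0[OF that]]] assms(15)[OF that] by (simp add: P_def)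

  have jac_lap: "jac \<Phi> (laplacian \<Phi>) x = 0" if "x \<in> D" for x
  proof -
    have der: "((\<lambda>y. laplacian \<Phi> y * (grad \<Phi> y \<bullet> axis i 1)) has_derivative
       (\<lambda>h. laplacian \<Phi> x * (grad (partial i \<Phi>) x \<bullet> h) + (grad (laplacian \<Phi>) x \<bullet> h) * partial i \<Phi> x)) (at x)"
      for i
      using has_derivative_mult[OF lap_diff[OF that, THEN has_derivative_grad] d1[OF that, THEN has_derivative_grad]]
      by (simp add: inner_axis grad_nth)
    show ?thesis
      using has_derivative_symmetric_second[OF \<open>open D\<close> that P der[of 1] der[of 2]] comm[OF that, of 1 2]
      by (simp add: jac_def inner_axis grad_nth algebra_simps)
  qed

  have "c\<^sub>0 > 0" using assms(2,4,5) by simp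
  \<comment> \<open>By the Lamb form, advection plus Coriolis term is the gradient of the expression
    in the second factor; dividing by \<open>- c\<^sub>0\<close> solves the momentum equation for
    \<open>\<pi>\<^sub>0\<close>.\<close>
  define \<pi>\<^sub>0 where "\<pi>\<^sub>0 = (\<lambda>y. (- 1 / c\<^sub>0) * ((1/2) * q y - P y + l * \<Phi> y))"
  define g where "g x = (- 1 / c\<^sub>0) *\<^sub>R ((1/2) *\<^sub>R grad q x - laplacian \<Phi> x *\<^sub>R grad \<Phi> x + l *\<^sub>R grad \<Phi> x)" for x
  have pi0: "(\<pi>\<^sub>0 has_derivative (\<lambda>h. g x \<bullet> h)) (at x)" if "x \<in> D" for x
    unfolding \<pi>\<^sub>0_def g_def
    by (rule derivative_eq_intros P[OF that] has_derivative_grad[OF q_diff[OF that]]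
        has_derivative_grad[OF d0[OF that]] refl)+
       (simp add: inner_left_distrib inner_diff_left)
  then have "\<pi>\<^sub>0 differentiable_on D"
    by (auto simp: differentiable_on_def differentiable_def intro: has_derivative_at_withinI)
  moreover have "grad \<pi>\<^sub>0 x \<bullet> perp_grad \<Phi> x = 0" if "x \<in> D" for x
  proof -
    \<comment> \<open>\<open>g x\<close> combines only \<open>grad q x\<close> and
      \<open>grad \<Phi> x\<close>, and both are orthogonal to \<open>perp_grad \<Phi> x\<close>
      because their Jacobians with \<open>\<Phi>\<close> vanish.\<close>
    have "jac \<Phi> \<Phi> x = 0" by (simp add: jac_def)
    then show ?thesis
      using jac_q[OF that]
      by (simp add: grad_eq[OF pi0[OF that]] g_def inner_left_distrib inner_diff_left inner_perp_grad)
  qed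
  moreover have "advect (perp_grad \<Phi>) (perp_grad \<Phi>) x + l *\<^sub>R (rot_mat *v perp_grad \<Phi> x)
      + c\<^sub>0 *\<^sub>R grad \<pi>\<^sub>0 x = 0" if "x \<in> D" for x
    using \<open>c\<^sub>0 > 0\<close> advect_perp_grad[OF d1[OF that] d1[OF that] comm[OF that]]
    by (simp add: grad_eq[OF pi0[OF that]] g_def rot_mat_perp_grad q_def)
  ultimately show ?thesis using jac_q jac_lap unfolding q_def by blast
qed

end
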